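(* Let $A\in\mathbb{C}^{n\times n}$ and $r_0\in\mathbb{C}^n$. Let $\mathcal{U},\widetilde{\mathcal{U}}\subseteq\mathbb{C}^n$ be $k$-dimensional subspaces and let $\mathcal{V}_j,\widetilde{\mathcal{V}}_j\subseteq\mathbb{C}^n$ be $j$-dimensional subspaces. Let $U,\widetilde U\in\mathbb{C}^{n\times k}$ be matrices whose columns form bases of $\mathcal{U}$ and $\widetilde{\mathcal{U}}$ respectively, assume $\widetilde U^*AU$ is invertible, and put $\Phi := AU(\widetilde U^*AU)^{-1}\widetilde U^*$. Then the following two problems are equivalent, i.e. a vector $t_j\in\mathcal{V}_j$ solves the first if and only if it solves the second: (1) (projected problem) find $t_j\in\mathcal{V}_j$ as an approximate solution of $(I-\Phi)At=(I-\Phi)r_0$ subject to the residual constraint $(I-\Phi)r_0-(I-\Phi)At_j\perp\widetilde{\mathcal{V}}_j$; (2) (unprojected problem) find $t_j\in\mathcal{V}_j$ as an approximate solution of $At=r_0$ subject to the residual constraint $r_0-At_j\perp\widetilde{\mathcal{W}}_j$, where $\widetilde{\mathcal{W}}_j:=(I-\Phi)^*\widetilde{\mathcal{V}}_j$.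
   Context: $I$ is the $n\times n$ identity matrix, ${}^*$ denotes conjugate transpose, and $\perp$ is orthogonality with respect to the standard Hermitian inner product on $\mathbb{C}^n$. $(I-\Phi)^*\widetilde{\mathcal{V}}_j$ denotes the image of the subspace $\widetilde{\mathcal{V}}_j$ under $(I-\Phi)^*$. Finding an "approximate solution" $t_j\in\mathcal{V}_j$ of a linear equation subject to a residual constraint means finding $t_j\in\mathcal{V}_j$ such that the residual (right-hand side minus left-hand side evaluated at $t_j$) satisfies the stated orthogonality condition. *)

theory Defs
  imports "Jordan_Normal_Form.VS_Connect" "Jordan_Normal_Form.Schur_Decomposition"
    "Jordan_Normal_Form.Gauss_Jordan_Elimination"
begin

abbreviation cspace :: "nat \<Rightarrow> (complex, complex vec) module" where
  "cspace n \<equiv> module_vec TYPE(complex) n"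

definition subspace_of_dim :: "nat \<Rightarrow> nat \<Rightarrow> complex vec set \<Rightarrow> bool" where
  "subspace_of_dim n d W \<longleftrightarrow>
     VectorSpace.subspace class_ring W (cspace n) \<and>
     vectorspace.fin_dim class_ring (cspace n\<lparr>carrier := W\<rparr>) \<and>
     vectorspace.dim class_ring (cspace n\<lparr>carrier := W\<rparr>) = d"

text \<open>Distinctness is required because \<^const>\<open>vectorspace.basis\<close> speaks about a set of
  vectors and would not notice a repeated column.\<close>

definition columns_form_basis :: "nat \<Rightarrow> complex mat \<Rightarrow> complex vec set \<Rightarrow> bool" where
  "columns_form_basis n B W \<longleftrightarrow>
     distinct (cols B) \<and>
     vectorspace.basis class_ring (cspace n\<lparr>carrier := W\<rparr>) (set (cols B))"

text \<open>\<open>U'\<close> is the matrix written \<open>U\<close> with a tilde. \<open>mat_inverse M\<close> is \<open>Some\<close> of the inverse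
  of \<open>M\<close> if \<open>M\<close> is invertible, and \<open>None\<close> otherwise.\<close>

definition Phi :: "complex mat \<Rightarrow> complex mat \<Rightarrow> complex mat \<Rightarrow> complex mat" where
  "Phi A U U' =
     A * U * the (mat_inverse (mat_adjoint U' * A * U)) * mat_adjoint U'"

definition orthogonal_to :: "complex vec \<Rightarrow> complex vec set \<Rightarrow> bool" where
  "orthogonal_to x W \<longleftrightarrow> (\<forall>w\<in>W. x \<bullet>c w = 0)"

definition approx_solution ::
    "complex mat \<Rightarrow> complex vec \<Rightarrow> complex vec set \<Rightarrow> complex vec set \<Rightarrow> complex vec \<Rightarrow> bool" where
  "approx_solution B b V W t \<longleftrightarrow> t \<in> V \<and> orthogonal_to (b - B *\<^sub>v t) W"

end

theory Submission
  imports Defs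
begin

text \<open>
  Orthogonality of a residual to the image of a subspace under an adjoint \<open>P\<^sup>*\<close> is orthogonality
  of \<open>P\<close> applied to that residual to the subspace itself, because
  \<open>\<langle>x, P\<^sup>* v\<rangle> = \<langle>P x, v\<rangle>\<close> (lemma \<open>cscalar_prod_mat_adjoint\<close>). Taking \<open>x = r\<^sub>0 - A t\<close>, whose image
  under \<open>P\<close> is the projected residual \<open>P r\<^sub>0 - P A t\<close> by linearity, turns each of the two residual
  constraints into the other. The search space is the same in both problems.
\<close>

lemma mat_adjoint_carrier:
  assumes "A \<in> carrier_mat m n"
  shows "mat_adjoint A \<in> carrier_mat n m"
  using assms by (auto simp: mat_adjoint_def)

lemma Phi_carrier:
  assumes "A \<in> carrier_mat n m" and "U' \<in> carrier_mat n k"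
  shows "Phi A U U' \<in> carrier_mat n n"
  using assms mat_adjoint_carrier[OF assms(2)] by (auto simp: Phi_def)

lemma subspace_of_dim_carrier:
  assumes "subspace_of_dim n d W"
  shows "W \<subseteq> carrier_vec n"
  using assms
  by (simp add: subspace_of_dim_def VectorSpace.subspace_def submodule_def module_vec_simps)

lemma mat_adjoint_mult_vec:
  assumes "A \<in> carrier_mat m n" and "v \<in> carrier_vec m"
  shows "mat_adjoint A *\<^sub>v v = conjugate (transpose_mat A *\<^sub>v conjugate v)"
proof (rule eq_vecI)
  fix i
  assume "i < dim_vec (conjugate (transpose_mat A *\<^sub>v conjugate v))"
  hence i: "i < n" using assms by simp
  have c: "col A i \<in> carrier_vec m" using assms i by auto
  have "(mat_adjoint A *\<^sub>v v) $ i = conjugate (col A i) \<bullet> v"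
    using assms i by (simp add: mat_adjoint_def)
  also have "\<dots> = conjugate (col A i \<bullet>c v)"
    by (simp flip: conjugate_conjugate_sprod[OF c assms(2)])
  also have "\<dots> = conjugate (transpose_mat A *\<^sub>v conjugate v) $ i"
    using assms i by simp
  finally show "(mat_adjoint A *\<^sub>v v) $ i = conjugate (transpose_mat A *\<^sub>v conjugate v) $ i" .
qed (use assms in \<open>simp add: mat_adjoint_def\<close>)

text \<open>Since the adjoint conjugates both the entries and the vector, the second conjugation in the
  Hermitian product cancels, and what remains is the bilinear transpose identity.\<close>

lemma cscalar_prod_mat_adjoint:
  assumes A: "A \<in> carrier_mat m n" and x: "x \<in> carrier_vec n" and v: "v \<in> carrier_vec m"
  shows "x \<bullet>c (mat_adjoint A *\<^sub>v v) = (A *\<^sub>v x) \<bullet>c v"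
proof -
  have cv: "conjugate v \<in> carrier_vec m" using v by simp
  have Tv: "transpose_mat A *\<^sub>v conjugate v \<in> carrier_vec n" using A cv by simp
  have "x \<bullet>c (mat_adjoint A *\<^sub>v v) = x \<bullet> (transpose_mat A *\<^sub>v conjugate v)"
    using A v by (simp add: mat_adjoint_mult_vec)
  also have "\<dots> = (transpose_mat A *\<^sub>v conjugate v) \<bullet> x"
    using comm_scalar_prod[OF x Tv] .
  also have "\<dots> = conjugate v \<bullet> (A *\<^sub>v x)"
    by (rule transpose_vec_mult_scalar[OF A x cv])
  also have "\<dots> = (A *\<^sub>v x) \<bullet>c v"
    using comm_scalar_prod[OF cv] A x by simp
  finally show ?thesis .
qed

lemma orthogonal_to_adjoint_image_iff:
  assumes "P \<in> carrier_mat m n" and "x \<in> carrier_vec n" and "W \<subseteq> carrier_vec m"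
  shows "orthogonal_to x ((\<lambda>v. mat_adjoint P *\<^sub>v v) ` W) \<longleftrightarrow> orthogonal_to (P *\<^sub>v x) W"
  using assms by (auto simp: orthogonal_to_def cscalar_prod_mat_adjoint[OF assms(1,2)] subset_iff)

theorem proposition4p1:
  fixes n k j :: nat
    and A U U' :: "complex mat"
    and r0 :: "complex vec"
    and \<U> \<U>' \<V> \<V>' :: "complex vec set"
  assumes "A \<in> carrier_mat n n"
    and "r0 \<in> carrier_vec n"
    and "subspace_of_dim n k \<U>" and "subspace_of_dim n k \<U>'"
    and "subspace_of_dim n j \<V>" and "subspace_of_dim n j \<V>'"
    and "U \<in> carrier_mat n k" and "columns_form_basis n U \<U>"
    and "U' \<in> carrier_mat n k" and "columns_form_basis n U' \<U>'"
    and "invertible_mat (mat_adjoint U' * A * U)"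
  defines "P \<equiv> 1\<^sub>m n - Phi A U U'"
  defines "\<W>' \<equiv> (\<lambda>v. mat_adjoint P *\<^sub>v v) ` \<V>'"
  shows "\<forall>t. approx_solution (P * A) (P *\<^sub>v r0) \<V> \<V>' t \<longleftrightarrow> approx_solution A r0 \<V> \<W>' t"
proof -
  have P: "P \<in> carrier_mat n n"
    unfolding P_def by (rule minus_carrier_mat[OF Phi_carrier[OF assms(1,9)]])
  have V: "\<V> \<subseteq> carrier_vec n" and V': "\<V>' \<subseteq> carrier_vec n"
    using assms(5,6) by (auto dest: subspace_of_dim_carrier)
  have "orthogonal_to (P *\<^sub>v r0 - (P * A) *\<^sub>v t) \<V>' \<longleftrightarrow> orthogonal_to (r0 - A *\<^sub>v t) \<W>'"
    if "t \<in> \<V>" for t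
  proof -
    have t: "t \<in> carrier_vec n" using V that by blast
    have At: "A *\<^sub>v t \<in> carrier_vec n" using assms(1) t by simp
    have "P *\<^sub>v r0 - (P * A) *\<^sub>v t = P *\<^sub>v (r0 - A *\<^sub>v t)"
      using mult_minus_distrib_mat_vec[OF P assms(2) At] assoc_mult_mat_vec[OF P assms(1) t]
      by simp
    thus ?thesis
      unfolding \<W>'_def using orthogonal_to_adjoint_image_iff[OF P _ V'] assms(2) At by simp
  qed
  thus ?thesis
    by (auto simp: approx_solution_def)
qed

end
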